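(* Let $X$ be a locally compact topometric space. Then the following are equivalent: (i) $X$ is CB-analysable. (ii) For every non-empty locally compact $Y\subseteq X$, the $d$-isolated points of the topometric space $Y$ (with the induced structure) are dense in $Y$. (iii) Every non-empty closed $Y\subseteq X$, viewed as a topometric space with the induced structure, contains a weakly $d$-isolated point.
   Context: A topometric space is a triple $(X,\mathscr{T},d)$ where $\mathscr{T}$ is a topology on $X$ and $d\colon X^2\to[0,\infty]$ is a metric (infinite distances allowed) such that (1) $d$ refines the topology: for every open $U$ and $x\in U$ there is $r>0$ with $\{y: d(x,y)<r\}\subseteq U$; (2) $d$ is lower semi-continuous: for every real $r\ge 0$ the set $\{(a,b): d(a,b)\le r\}$ is closed in $X^2$. Topological terms (open, closed, compact, locally compact, dense, interior) refer to $\mathscr{T}$. Subsets carry the induced topology and metric. Let $B(x,r)=\{y: d(x,y)<r\}$ and let ${}^\circ$ denote topological interior. A point $x\in X$ is $d$-isolated if $x\in B(x,r)^\circ$ for all $r>0$; it is weakly $d$-isolated if $B(x,r)^\circ\neq\varnothing$ for all $r>0$. For $\varepsilon>0$ let $X'_{d,\varepsilon}=X\setminus\bigcup\{U\subseteq X\text{ open}: \mathrm{diam}(U)\le\varepsilon\}$; let $X^{(0)}_{d,\varepsilon}=X$, $X^{(\alpha+1)}_{d,\varepsilon}=(X^{(\alpha)}_{d,\varepsilon})'_{d,\varepsilon}$, and take intersections at limit ordinals. $X$ is CB-analysable if $\bigcap_\alpha X^{(\alpha)}_{d,\varepsilon}=\varnothing$ for every $\varepsilon>0$. (Using "open and $\varepsilon$-finite"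 or "open and $\varepsilon$-bounded" sets in place of open sets of diameter $\le\varepsilon$ gives an equivalent notion of CB-analysability.) *)

theory Defs
  imports "HOL-Analysis.Analysis"
begin

text \<open>
  The underlying set of a topometric space is \<^term>\<open>topspace T\<close>; the values of \<^term>\<open>d\<close> outside
  it are irrelevant. The induced structure on a subset \<open>Y\<close> is therefore given by
  \<^term>\<open>subtopology T Y\<close> and the same function \<^term>\<open>d\<close> (see \<open>topometric_space_subtopology\<close>).
\<close>

definition d_ball :: "'a topology \<Rightarrow> ('a \<Rightarrow> 'a \<Rightarrow> ennreal) \<Rightarrow> 'a \<Rightarrow> real \<Rightarrow> 'a set" where
  "d_ball T d x r = {y \<in> topspace T. d x y < ennreal r}"

locale topometric_space =
  fixes T :: "'a topology" and d :: "'a \<Rightarrow> 'a \<Rightarrow> ennreal"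
  assumes dist_eq_0: "\<lbrakk>x \<in> topspace T; y \<in> topspace T\<rbrakk> \<Longrightarrow> d x y = 0 \<longleftrightarrow> x = y"
    and dist_sym: "\<lbrakk>x \<in> topspace T; y \<in> topspace T\<rbrakk> \<Longrightarrow> d x y = d y x"
    and dist_triangle: "\<lbrakk>x \<in> topspace T; y \<in> topspace T; z \<in> topspace T\<rbrakk>
      \<Longrightarrow> d x z \<le> d x y + d y z"
    and dist_refines: "\<lbrakk>openin T U; x \<in> U\<rbrakk> \<Longrightarrow> \<exists>r>0. d_ball T d x r \<subseteq> U"
    and dist_lsc: "r \<ge> 0 \<Longrightarrow>
      closedin (prod_topology T T)
        {(a, b). a \<in> topspace T \<and> b \<in> topspace T \<and> d a b \<le> ennreal r}"

definition d_isolated :: "'a topology \<Rightarrow> ('a \<Rightarrow> 'a \<Rightarrow> ennreal) \<Rightarrow> 'a \<Rightarrow> bool" where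
  "d_isolated T d x \<longleftrightarrow> x \<in> topspace T \<and> (\<forall>r>0. x \<in> T interior_of (d_ball T d x r))"

definition weakly_d_isolated :: "'a topology \<Rightarrow> ('a \<Rightarrow> 'a \<Rightarrow> ennreal) \<Rightarrow> 'a \<Rightarrow> bool" where
  "weakly_d_isolated T d x \<longleftrightarrow>
     x \<in> topspace T \<and> (\<forall>r>0. T interior_of (d_ball T d x r) \<noteq> {})"

definition d_diam :: "('a \<Rightarrow> 'a \<Rightarrow> ennreal) \<Rightarrow> 'a set \<Rightarrow> ennreal" where
  "d_diam d U = (SUP x\<in>U. SUP y\<in>U. d x y)"

definition cb_derivative :: "'a topology \<Rightarrow> ('a \<Rightarrow> 'a \<Rightarrow> ennreal) \<Rightarrow> real \<Rightarrow> 'a set" where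
  "cb_derivative T d \<epsilon> = topspace T - \<Union> {U. openin T U \<and> d_diam d U \<le> ennreal \<epsilon>}"

text \<open>
  Ordinals are represented by the elements of well-orders: an element \<open>a\<close> of a (reflexive)
  well-order \<open>r\<close> stands for the order type of \<^term>\<open>underS r a\<close>.
\<close>

definition immediate_pred :: "'i rel \<Rightarrow> 'i \<Rightarrow> 'i \<Rightarrow> bool" where
  "immediate_pred r b a \<longleftrightarrow> b \<in> underS r a \<and> (\<forall>c \<in> underS r a. (c, b) \<in> r)"

definition cb_iter ::
  "'a topology \<Rightarrow> ('a \<Rightarrow> 'a \<Rightarrow> ennreal) \<Rightarrow> real \<Rightarrow> 'i rel \<Rightarrow> 'i \<Rightarrow> 'a set" where
  "cb_iter T d \<epsilon> r = wo_rel.worec r (\<lambda>S a.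
     if underS r a = {} then topspace T
     else if \<exists>b. immediate_pred r b a
       then cb_derivative (subtopology T (S (THE b. immediate_pred r b a))) d \<epsilon>
     else (\<Inter>b \<in> underS r a. S b))"

text \<open>
  The intersection of the iterated derivatives over all ordinals. Well-orders on subsets of
  \<^typ>\<open>'a set\<close> suffice: they are long enough for the sequence to become stationary, so longer
  well-orders (on any type) contribute nothing new. This is proved below in
  \<open>cb_kernel_fixpoint\<close> and \<open>cb_kernel_subset_cb_iter\<close>.
\<close>

definition cb_kernel :: "'a topology \<Rightarrow> ('a \<Rightarrow> 'a \<Rightarrow> ennreal) \<Rightarrow> real \<Rightarrow> 'a set" where
  "cb_kernel T d \<epsilon> =
     \<Inter> {cb_iter T d \<epsilon> r a | (r :: 'a set rel) a. Well_order r \<and> a \<in> Field r}"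

definition cb_analysable :: "'a topology \<Rightarrow> ('a \<Rightarrow> 'a \<Rightarrow> ennreal) \<Rightarrow> bool" where
  "cb_analysable T d \<longleftrightarrow> (\<forall>\<epsilon>>0. cb_kernel T d \<epsilon> = {})"


lemma topometric_space_subtopology:
  assumes "topometric_space T d"
  shows "topometric_space (subtopology T Y) d"
proof -
  interpret topometric_space T d by fact
  show ?thesis
  proof
    fix U x assume U: "openin (subtopology T Y) U" "x \<in> U"
    then obtain V where V: "openin T V" "U = V \<inter> Y" by (auto simp: openin_subtopology)
    then obtain r where "r > 0" "d_ball T d x r \<subseteq> V" using dist_refines U by blast
    then show "\<exists>r>0. d_ball (subtopology T Y) d x r \<subseteq> U"
      using V by (auto simp: d_ball_def)
  next
    fix r :: real assume "r \<ge> 0"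
    have "{(a, b). a \<in> topspace (subtopology T Y) \<and> b \<in> topspace (subtopology T Y) \<and> d a b \<le> ennreal r}
      = {(a, b). a \<in> topspace T \<and> b \<in> topspace T \<and> d a b \<le> ennreal r} \<inter> (Y \<times> Y)"
      by auto
    then show "closedin (prod_topology (subtopology T Y) (subtopology T Y))
        {(a, b). a \<in> topspace (subtopology T Y) \<and> b \<in> topspace (subtopology T Y) \<and> d a b \<le> ennreal r}"
      using dist_lsc[OF \<open>r \<ge> 0\<close>] by (auto simp: subtopology_Times[symmetric] closedin_subtopology)
  qed (use dist_eq_0 dist_sym dist_triangle in auto)
qed

lemma topometric_space_Hausdorff:
  assumes "topometric_space T d"
  shows "Hausdorff_space T"
proof -
  interpret topometric_space T d by fact
  have "{(a, b). a \<in> topspace T \<and> b \<in> topspace T \<and> d a b \<le> ennreal 0} = (\<lambda>x. (x, x)) ` topspace T"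
    using dist_eq_0 by auto
  then show ?thesis
    using dist_lsc[of 0] by (simp add: Hausdorff_space_closedin_diagonal)
qed

lemma d_diam_mono: "A \<subseteq> B \<Longrightarrow> d_diam d A \<le> d_diam d B"
  unfolding d_diam_def by (intro SUP_mono) (meson SUP_mono order_refl subsetD)

lemma cb_derivative_subset: "cb_derivative T d \<epsilon> \<subseteq> topspace T"
  by (auto simp: cb_derivative_def)

lemma cb_derivative_mono:
  assumes "A \<subseteq> B"
  shows "cb_derivative (subtopology T A) d \<epsilon> \<subseteq> cb_derivative (subtopology T B) d \<epsilon>"
proof
  fix x assume x: "x \<in> cb_derivative (subtopology T A) d \<epsilon>"
  have xA: "x \<in> topspace T" "x \<in> A" using x by (auto simp: cb_derivative_def)
  have "d_diam d U > ennreal \<epsilon>" if U: "openin (subtopology T B) U" "x \<in> U" for U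
  proof (rule ccontr)
    assume "\<not> d_diam d U > ennreal \<epsilon>"
    then have "d_diam d (U \<inter> A) \<le> ennreal \<epsilon>"
      using d_diam_mono[of "U \<inter> A" U d] by (meson inf_le1 linorder_not_less order_trans)
    moreover have "openin (subtopology T A) (U \<inter> A)"
      using U(1) \<open>A \<subseteq> B\<close> by (auto simp: openin_subtopology)
    ultimately show False using x U(2) xA by (auto simp: cb_derivative_def)
  qed
  then show "x \<in> cb_derivative (subtopology T B) d \<epsilon>"
    using xA \<open>A \<subseteq> B\<close> by (fastforce simp: cb_derivative_def)
qed

lemma immediate_pred_the:
  assumes "Well_order r" "immediate_pred r b a"
  shows "(THE b. immediate_pred r b a) = b"
proof (rule the_equality)
  show "c = b" if "immediate_pred r c a" for c
    using assms that wo_rel.ANTISYM[of r] unfolding immediate_pred_def wo_rel_def antisym_def by blast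
qed (rule assms)

lemma cb_iter_unfold:
  assumes "Well_order r"
  shows "cb_iter T d \<epsilon> r a =
    (if underS r a = {} then topspace T
     else if \<exists>b. immediate_pred r b a
       then cb_derivative (subtopology T (cb_iter T d \<epsilon> r (THE b. immediate_pred r b a))) d \<epsilon>
     else (\<Inter>b \<in> underS r a. cb_iter T d \<epsilon> r b))"
proof -
  interpret wo_rel r using assms by (simp add: wo_rel_def)
  let ?H = "\<lambda>S a. if underS a = {} then topspace T
     else if \<exists>b. immediate_pred r b a
       then cb_derivative (subtopology T (S (THE b. immediate_pred r b a))) d \<epsilon>
     else (\<Inter>b \<in> underS a. S b)"
  have "(THE b. immediate_pred r b a) \<in> underS a" if "immediate_pred r b a" for a b
    using immediate_pred_the[OF assms that] that by (simp add: immediate_pred_def)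
  then have "adm_wo ?H"
    unfolding adm_wo_def by auto
  from worec_fixpoint[OF this] show ?thesis
    unfolding cb_iter_def by (rule fun_cong)
qed

lemma cb_iter_zero:
  "\<lbrakk>Well_order r; underS r a = {}\<rbrakk> \<Longrightarrow> cb_iter T d \<epsilon> r a = topspace T"
  by (subst cb_iter_unfold) auto

lemma cb_iter_succ:
  assumes "Well_order r" "immediate_pred r b a"
  shows "cb_iter T d \<epsilon> r a = cb_derivative (subtopology T (cb_iter T d \<epsilon> r b)) d \<epsilon>"
proof -
  have "underS r a \<noteq> {}" using assms(2) by (auto simp: immediate_pred_def)
  then show ?thesis
    using assms cb_iter_unfold[OF assms(1), of T d \<epsilon> a] immediate_pred_the[OF assms] by auto
qed

lemma cb_iter_limit:
  "\<lbrakk>Well_order r; underS r a \<noteq> {}; \<nexists>b. immediate_pred r b a\<rbrakk>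
    \<Longrightarrow> cb_iter T d \<epsilon> r a = (\<Inter>b \<in> underS r a. cb_iter T d \<epsilon> r b)"
  by (subst cb_iter_unfold) auto

lemma cb_iter_greatest:
  assumes r: "Well_order r" and K: "K \<subseteq> topspace T" "cb_derivative (subtopology T K) d \<epsilon> = K"
  shows "K \<subseteq> cb_iter T d \<epsilon> r a"
proof -
  interpret wo_rel r using r by (simp add: wo_rel_def)
  show ?thesis
  proof (induction a rule: well_order_induct)
    case (1 a)
    then have IH: "K \<subseteq> cb_iter T d \<epsilon> r b" if "b \<in> underS a" for b
      using that by (auto simp: underS_def)
    consider "underS a = {}" | b where "immediate_pred r b a"
      | "underS a \<noteq> {}" "\<nexists>b. immediate_pred r b a" by blast
    then show ?case
    proof cases
      case (2 b)
      then show ?thesis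
        using cb_iter_succ[OF r 2, of T d \<epsilon>] cb_derivative_mono[OF IH[of b], of T d \<epsilon>] K
        by (simp add: immediate_pred_def)
    qed (use IH K r in \<open>auto simp: cb_iter_zero cb_iter_limit\<close>)
  qed
qed

lemma cb_iter_subset_topspace:
  assumes "Well_order r"
  shows "cb_iter T d \<epsilon> r a \<subseteq> topspace T"
proof -
  interpret wo_rel r using assms by (simp add: wo_rel_def)
  show ?thesis
  proof (induction a rule: well_order_induct)
    case (1 a)
    consider "underS a = {}" | b where "immediate_pred r b a"
      | "underS a \<noteq> {}" "\<nexists>b. immediate_pred r b a" by blast
    then show ?case
    proof cases
      case (2 b)
      then show ?thesis
        using cb_iter_succ[OF assms 2, of T d \<epsilon>] cb_derivative_subset[of "subtopology T (cb_iter T d \<epsilon> r b)" d \<epsilon>]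
        by auto
    next
      case 3
      then obtain b where b: "b \<in> underS a" by blast
      then have "cb_iter T d \<epsilon> r b \<subseteq> topspace T" using 1 by (simp add: underS_def)
      then show ?thesis using cb_iter_limit[OF assms 3, of T d \<epsilon>] b by blast
    qed (use assms in \<open>simp add: cb_iter_zero\<close>)
  qed
qed

lemma cb_iter_decreasing:
  assumes r: "Well_order r" and "b \<in> underS r a"
  shows "cb_iter T d \<epsilon> r a \<subseteq> cb_derivative (subtopology T (cb_iter T d \<epsilon> r b)) d \<epsilon>"
proof -
  interpret wo_rel r using r by (simp add: wo_rel_def)
  show ?thesis using assms(2)
  proof (induction a rule: well_order_induct)
    case (1 a)
    then have IH: "cb_iter T d \<epsilon> r c \<subseteq> cb_derivative (subtopology T (cb_iter T d \<epsilon> r b)) d \<epsilon>"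
      if "c \<in> underS a" "b \<in> underS c" for c
      using that by (auto simp: underS_def)
    show ?case
    proof (cases "\<exists>c. immediate_pred r c a")
      case True
      then obtain c where c: "immediate_pred r c a" by blast
      then have bc: "c \<in> underS a" "b = c \<or> b \<in> underS c"
        using 1(2) by (auto simp: immediate_pred_def underS_def)
      have "cb_derivative (subtopology T (cb_iter T d \<epsilon> r c)) d \<epsilon> \<subseteq> cb_iter T d \<epsilon> r c"
        by (auto simp: cb_derivative_def)
      then show ?thesis using cb_iter_succ[OF r c, of T d \<epsilon>] bc IH by auto
    next
      case False
      then obtain c where c: "c \<in> underS a" "(c, b) \<notin> r"
        using 1(2) by (auto simp: immediate_pred_def)
      then have "b \<in> underS c"
        using 1(2) TOTALS by (fastforce simp: underS_def Field_def)
      then have "cb_iter T d \<epsilon> r c \<subseteq> cb_derivative (subtopology T (cb_iter T d \<epsilon> r b)) d \<epsilon>"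
        by (rule IH[OF c(1)])
      moreover have "cb_iter T d \<epsilon> r a \<subseteq> cb_iter T d \<epsilon> r c"
        using cb_iter_limit[OF r _ False, of T d \<epsilon>] c(1) by auto
      ultimately show ?thesis by (rule subset_trans[rotated])
    qed
  qed
qed

lemma cb_iter_stationary:
  obtains r :: "'a set rel" and a
  where "Well_order r" "a \<in> Field r"
    "cb_derivative (subtopology (T :: 'a topology) (cb_iter T d \<epsilon> r a)) d \<epsilon> = cb_iter T d \<epsilon> r a"
proof -
  obtain r :: "'a set rel" where r: "Well_order r" "Field r = UNIV"
    using well_ordering[where 'a = "'a set"] by (elim exE conjE)
  interpret wo_rel r using r by (simp add: wo_rel_def)
  let ?S = "cb_iter T d \<epsilon> r" and ?D = "\<lambda>A. cb_derivative (subtopology T A) d \<epsilon>"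
  have "\<exists>a. ?D (?S a) = ?S a"
  proof (rule ccontr)
    assume *: "\<not> ?thesis"
    have "?D A \<subseteq> A" for A by (auto simp: cb_derivative_def)
    with * have "\<forall>a. \<exists>x. x \<in> ?S a - ?D (?S a)" by blast
    then obtain f where f: "f a \<in> ?S a - ?D (?S a)" for a by metis
    have "f a \<noteq> f b" if "b \<in> underS a" for a b
      using cb_iter_decreasing[OF r(1) that, of T d \<epsilon>] f[of a] f[of b] by auto
    moreover have "a = b \<or> a \<in> underS b \<or> b \<in> underS a" for a b
      using TOTALS r(2) by (auto simp: underS_def)
    ultimately have "inj f" unfolding inj_on_def by metis
    then have "surj (inv f)" by (rule inj_imp_surj_inv)
    then have "inv f ` UNIV = Pow UNIV" by simp
    then show False using Cantors_theorem[of UNIV] by blast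
  qed
  then obtain a where "?D (?S a) = ?S a" by (elim exE)
  then show thesis using that[OF r(1), of a] r(2) by simp
qed

lemma cb_kernel_eq:
  assumes r: "Well_order r"
    and stat: "cb_derivative (subtopology (T :: 'a topology) (cb_iter T d \<epsilon> r a)) d \<epsilon> = cb_iter T d \<epsilon> r a"
    and a: "a \<in> Field (r :: 'a set rel)"
  shows "cb_kernel T d \<epsilon> = cb_iter T d \<epsilon> r a"
proof
  show "cb_kernel T d \<epsilon> \<subseteq> cb_iter T d \<epsilon> r a"
    unfolding cb_kernel_def using r a by blast
  have "cb_iter T d \<epsilon> r a \<subseteq> cb_iter T d \<epsilon> s b" if "Well_order s" for s :: "'a set rel" and b
    by (rule cb_iter_greatest[OF that cb_iter_subset_topspace[OF r] stat])
  then show "cb_iter T d \<epsilon> r a \<subseteq> cb_kernel T d \<epsilon>"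
    unfolding cb_kernel_def by blast
qed

theorem cb_kernel_fixpoint:
  "cb_derivative (subtopology T (cb_kernel T d \<epsilon>)) d \<epsilon> = cb_kernel T d \<epsilon>"
proof (rule cb_iter_stationary[of T d \<epsilon>])
  fix r :: "'a set rel" and a
  assume *: "Well_order r" "a \<in> Field r"
    "cb_derivative (subtopology T (cb_iter T d \<epsilon> r a)) d \<epsilon> = cb_iter T d \<epsilon> r a"
  show ?thesis using cb_kernel_eq[OF *(1,3,2)] *(3) by simp
qed

theorem cb_kernel_subset_cb_iter:
  assumes "Well_order (s :: 'i rel)"
  shows "cb_kernel T d \<epsilon> \<subseteq> cb_iter T d \<epsilon> s b"
proof -
  have "cb_kernel T d \<epsilon> \<subseteq> topspace T"
    using cb_derivative_subset[of "subtopology T (cb_kernel T d \<epsilon>)" d \<epsilon>]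
    by (simp add: cb_kernel_fixpoint)
  then show ?thesis by (rule cb_iter_greatest[OF assms _ cb_kernel_fixpoint])
qed

end

theory Submission
  imports Defs
begin

text \<open>
  The iterated derivatives enter only through their kernel, which is the largest set equal to its
  own derivative. This gives a description free of ordinals (\<open>cb_analysable_iff_fragmented\<close>):
  \<open>T\<close> is CB-analysable exactly when it is fragmented by \<open>d\<close>, that is, when every non-empty subset
  has non-empty relatively open pieces of arbitrarily small diameter. Indeed, the sets without
  such pieces of diameter at most \<open>\<epsilon>\<close> are the ones equal to their own \<open>\<epsilon>\<close>-derivative.

  If \<open>T\<close> is fragmented and \<open>Y\<close> is locally compact, then inside any non-empty relatively open subset
  of \<open>Y\<close> one can choose a decreasing sequence of compact sets with non-empty interior, each
  contained in the interior of its predecessor, whose diameters tend to \<open>0\<close>. A point of the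
  intersection is \<open>d\<close>-isolated. This Baire-category style argument (\<open>fragmented_imp_d_isolated\<close>)
  shows that (i) implies (ii). Closed subsets of \<open>T\<close> are locally compact, so (ii) implies (iii).

  Finally, assume (iii) and suppose that the kernel for some \<open>\<epsilon>\<close> is non-empty. Its closure has no
  non-empty relatively open subset of diameter at most \<open>\<epsilon>\<close> either, because such a set would meet
  the kernel. But around a weakly \<open>d\<close>-isolated point of the closure, the interior of the
  \<open>d\<close>-ball of radius \<open>\<epsilon> / 2\<close> is a set of exactly this kind, which is a contradiction.
\<close>

lemma d_diam_leI:
  assumes "\<And>x y. \<lbrakk>x \<in> U; y \<in> U\<rbrakk> \<Longrightarrow> d x y \<le> c"
  shows "d_diam d U \<le> c"
  unfolding d_diam_def by (intro SUP_least assms)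

lemma dist_le_d_diam:
  assumes "x \<in> U" "y \<in> U"
  shows "d x y \<le> d_diam d U"
  unfolding d_diam_def using assms by (meson SUP_upper SUP_upper2)

lemma (in topometric_space) d_diam_d_ball_le:
  assumes "x \<in> topspace T" "r > 0"
  shows "d_diam d (d_ball T d x r) \<le> ennreal (2 * r)"
proof (rule d_diam_leI)
  fix y z assume yz: "y \<in> d_ball T d x r" "z \<in> d_ball T d x r"
  then have "d y z \<le> d x y + d x z"
    using dist_triangle[of y x z] dist_sym[of x y] assms(1) by (auto simp: d_ball_def)
  also have "\<dots> \<le> ennreal r + ennreal r"
    using yz by (intro add_mono) (auto simp: d_ball_def)
  also have "\<dots> = ennreal (2 * r)"
    using assms(2) by (simp flip: ennreal_plus)
  finally show "d y z \<le> ennreal (2 * r)" .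
qed

lemma cb_derivative_eq_self_iff:
  assumes "K \<subseteq> topspace T"
  shows "cb_derivative (subtopology T K) d \<epsilon> = K \<longleftrightarrow>
    (\<forall>U. openin (subtopology T K) U \<and> d_diam d U \<le> ennreal \<epsilon> \<longrightarrow> U = {})"
proof -
  have K: "topspace (subtopology T K) = K"
    using assms by auto
  have "U \<subseteq> K" if "openin (subtopology T K) U" for U
    using openin_subset[OF that] K by simp
  then show ?thesis
    unfolding cb_derivative_def K by blast
qed

lemma cb_kernel_greatest:
  fixes T :: "'a topology"
  assumes "K \<subseteq> topspace T" "cb_derivative (subtopology T K) d \<epsilon> = K"
  shows "K \<subseteq> cb_kernel T d \<epsilon>"
proof -
  have "K \<subseteq> cb_iter T d \<epsilon> r a" if "Well_order r" for r :: "'a set rel" and a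
    by (rule cb_iter_greatest[OF that assms])
  then show ?thesis
    unfolding cb_kernel_def by blast
qed

lemma cb_kernel_subset_topspace: "cb_kernel T d \<epsilon> \<subseteq> topspace T"
  using cb_derivative_subset[of "subtopology T (cb_kernel T d \<epsilon>)" d \<epsilon>]
  by (simp add: cb_kernel_fixpoint)

text \<open>
  The condition on the right says that \<open>d\<close> fragments \<open>T\<close>. It no longer mentions ordinals and is
  visibly inherited by every subset.
\<close>

lemma cb_analysable_iff_fragmented:
  "cb_analysable T d \<longleftrightarrow>
    (\<forall>\<epsilon>>0. \<forall>Z. Z \<subseteq> topspace T \<and> Z \<noteq> {} \<longrightarrow>
      (\<exists>U. openin (subtopology T Z) U \<and> U \<noteq> {} \<and> d_diam d U \<le> ennreal \<epsilon>))"
    (is "_ \<longleftrightarrow> (\<forall>\<epsilon>>0. ?fragmented \<epsilon>)")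
proof -
  let ?perfect = "\<lambda>\<epsilon> Z. cb_derivative (subtopology T Z) d \<epsilon> = Z"
  have "cb_kernel T d \<epsilon> = {} \<longleftrightarrow> (\<forall>Z. Z \<subseteq> topspace T \<and> Z \<noteq> {} \<longrightarrow> \<not> ?perfect \<epsilon> Z)" for \<epsilon>
    using cb_kernel_greatest[of _ T d \<epsilon>] cb_kernel_subset_topspace[of T d \<epsilon>]
      cb_kernel_fixpoint[of T d \<epsilon>]
    by (metis subset_empty)
  moreover have "\<not> ?perfect \<epsilon> Z \<longleftrightarrow>
      (\<exists>U. openin (subtopology T Z) U \<and> U \<noteq> {} \<and> d_diam d U \<le> ennreal \<epsilon>)"
    if "Z \<subseteq> topspace T" for Z \<epsilon>
    unfolding cb_derivative_eq_self_iff[OF that] by blast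
  ultimately have "cb_kernel T d \<epsilon> = {} \<longleftrightarrow> ?fragmented \<epsilon>" for \<epsilon>
    by (simp cong: imp_cong)
  then show ?thesis
    by (simp only: cb_analysable_def)
qed

text \<open>
  A relatively open piece of the closure meets \<open>K\<close> as soon as it is non-empty, and its trace on
  \<open>K\<close> is relatively open with no larger diameter. Hence a condition on closed sets can be
  brought to bear on the kernel by way of its closure.
\<close>

lemma cb_derivative_closure_of_eq_self:
  assumes "K \<subseteq> topspace T" "cb_derivative (subtopology T K) d \<epsilon> = K"
  shows "cb_derivative (subtopology T (T closure_of K)) d \<epsilon> = T closure_of K"
proof -
  have "U = {}" if U: "openin (subtopology T (T closure_of K)) U" "d_diam d U \<le> ennreal \<epsilon>" for U
  proof -
    obtain V where V: "openin T V" "U = V \<inter> T closure_of K"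
      using U(1) by (auto simp: openin_subtopology)
    have "V \<inter> K \<subseteq> U"
      using V closure_of_subset[OF assms(1)] by blast
    then have "d_diam d (V \<inter> K) \<le> ennreal \<epsilon>"
      using d_diam_mono U(2) by (meson order_trans)
    moreover have "openin (subtopology T K) (V \<inter> K)"
      using V(1) by (auto simp: openin_subtopology)
    ultimately have "V \<inter> K = {}"
      using assms cb_derivative_eq_self_iff[OF assms(1)] by blast
    then show ?thesis
      using V openin_Int_closure_of_eq_empty[OF V(1), of K] by simp
  qed
  then show ?thesis
    by (simp add: cb_derivative_eq_self_iff closure_of_subset_topspace)
qed

text \<open>
  The point is found as in the proof of Baire's theorem: compactness supplies a point of the nested
  intersection, and the interiors keep that point inside open sets of arbitrarily small diameter.
\<close>

lemma fragmented_imp_d_isolated: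
  assumes lc: "locally_compact_space S" and H: "Hausdorff_space S"
    and small: "\<And>V \<epsilon>. \<lbrakk>openin S V; V \<noteq> {}; \<epsilon> > 0\<rbrakk>
      \<Longrightarrow> \<exists>U. openin S U \<and> U \<noteq> {} \<and> U \<subseteq> V \<and> d_diam d U \<le> ennreal \<epsilon>"
    and V: "openin S V" "V \<noteq> {}"
  shows "\<exists>x\<in>V. d_isolated S d x"
proof -
  define P where "P = (\<lambda>(n::nat) C. compactin S C \<and> closedin S C \<and> S interior_of C \<noteq> {} \<and> C \<subseteq> V
    \<and> d_diam d C \<le> ennreal (inverse (real (Suc n))))"
  have shrink: "\<exists>C. P n C \<and> C \<subseteq> W" if W: "openin S W" "W \<noteq> {}" "W \<subseteq> V" for W n
  proof -
    obtain U where U: "openin S U" "U \<noteq> {}" "U \<subseteq> W"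
        "d_diam d U \<le> ennreal (inverse (real (Suc n)))"
      using small[OF W(1,2), of "inverse (real (Suc n))"] by auto
    have "neighbourhood_base_of (\<lambda>C. compactin S C \<and> closedin S C) S"
      using lc H locally_compact_space_neighbourhood_base_closedin by blast
    with U(1,2) obtain O' C where C: "openin S O'" "compactin S C" "closedin S C"
        "O' \<noteq> {}" "O' \<subseteq> C" "C \<subseteq> U"
      unfolding neighbourhood_base_of by (metis ex_in_conv)
    then have "S interior_of C \<noteq> {}"
      using interior_of_maximal by blast
    moreover have "d_diam d C \<le> ennreal (inverse (real (Suc n)))"
      using d_diam_mono[OF C(6)] U(4) by (rule order_trans)
    ultimately show ?thesis
      unfolding P_def using C U W by blast
  qed
  have "\<exists>C. \<forall>n. P n (C n) \<and> C (Suc n) \<subseteq> S interior_of (C n)"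
  proof (rule dependent_nat_choice)
    show "\<exists>C. P 0 C"
      using shrink V by blast
    show "\<exists>D. P (Suc n) D \<and> D \<subseteq> S interior_of C" if "P n C" for C n
    proof (rule shrink)
      show "S interior_of C \<noteq> {}" "S interior_of C \<subseteq> V"
        using that interior_of_subset[of S C] unfolding P_def by blast+
    qed simp
  qed
  then obtain C where C: "\<And>n. P n (C n)" "\<And>n. C (Suc n) \<subseteq> S interior_of (C n)"
    by blast
  have "decseq C"
    by (rule decseq_SucI) (rule subset_trans[OF C(2) interior_of_subset])
  have "(\<Inter>n. C n) \<noteq> {}"
  proof (rule compact_space_imp_nest[OF _ _ _ \<open>decseq C\<close>])
    show "compact_space (subtopology S (C 0))"
      using C(1) by (simp add: P_def compact_space_subtopology)
    show "closedin (subtopology S (C 0)) (C n)" for n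
      using C(1) decseqD[OF \<open>decseq C\<close>] by (simp add: P_def closedin_subset_topspace)
    show "C n \<noteq> {}" for n
      using C(1)[of n] by (auto simp: P_def)
  qed
  then obtain x where x: "\<And>n. x \<in> C n"
    by blast
  have xS: "x \<in> topspace S"
    using x[of 0] C(1)[of 0] closedin_subset by (auto simp: P_def)
  have "x \<in> S interior_of (d_ball S d x r)" if "r > 0" for r
  proof -
    obtain n where n: "inverse (real (Suc n)) < r"
      using reals_Archimedean[OF \<open>r > 0\<close>] by auto
    have "C n \<subseteq> d_ball S d x r"
    proof
      fix y assume y: "y \<in> C n"
      have "d x y \<le> ennreal (inverse (real (Suc n)))"
        using dist_le_d_diam[OF x y] C(1)[of n] unfolding P_def by (meson order_trans)
      also have "\<dots> < ennreal r"
        using n \<open>r > 0\<close> by (simp add: ennreal_lessI)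
      finally show "y \<in> d_ball S d x r"
        using y C(1)[of n] closedin_subset by (auto simp: P_def d_ball_def)
    qed
    then have "S interior_of (C n) \<subseteq> S interior_of (d_ball S d x r)"
      by (rule interior_of_mono)
    then show ?thesis
      using x[of "Suc n"] C(2)[of n] by blast
  qed
  then have "d_isolated S d x"
    using xS by (simp add: d_isolated_def)
  moreover have "x \<in> V"
    using x[of 0] C(1)[of 0] by (auto simp: P_def)
  ultimately show ?thesis
    by blast
qed

lemma d_isolated_imp_weakly_d_isolated: "d_isolated T d x \<Longrightarrow> weakly_d_isolated T d x"
  by (auto simp: d_isolated_def weakly_d_isolated_def)

theorem corollary3p8:
  fixes T :: "'a topology" and d :: "'a \<Rightarrow> 'a \<Rightarrow> ennreal"
  assumes "topometric_space T d"
    and "locally_compact_space T"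
  shows
    "(cb_analysable T d
      \<longleftrightarrow> (\<forall>Y. Y \<subseteq> topspace T \<and> Y \<noteq> {} \<and> locally_compact_space (subtopology T Y)
            \<longrightarrow> subtopology T Y closure_of {x. d_isolated (subtopology T Y) d x} = Y))
     \<and> (cb_analysable T d
      \<longleftrightarrow> (\<forall>Y. closedin T Y \<and> Y \<noteq> {} \<longrightarrow> (\<exists>x. weakly_d_isolated (subtopology T Y) d x)))"
    (is "(?i \<longleftrightarrow> ?ii) \<and> (?i \<longleftrightarrow> ?iii)")
proof -
  have i_ii: ?ii if ?i
  proof (intro allI impI)
    fix Y
    assume Y: "Y \<subseteq> topspace T \<and> Y \<noteq> {} \<and> locally_compact_space (subtopology T Y)"
    let ?S = "subtopology T Y"
    have S: "topspace ?S = Y"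
      using Y by auto
    have H: "Hausdorff_space ?S"
      by (rule topometric_space_Hausdorff[OF topometric_space_subtopology[OF assms(1)]])
    have small: "\<exists>U. openin ?S U \<and> U \<noteq> {} \<and> U \<subseteq> V \<and> d_diam d U \<le> ennreal \<epsilon>"
      if V: "openin ?S V" "V \<noteq> {}" and "\<epsilon> > 0" for V \<epsilon>
    proof -
      have "V \<subseteq> Y"
        using openin_subset[OF V(1)] S by simp
      then have "V \<subseteq> topspace T"
        using Y by blast
      then obtain U where U: "openin (subtopology T V) U" "U \<noteq> {}" "d_diam d U \<le> ennreal \<epsilon>"
        using \<open>?i\<close> V(2) \<open>\<epsilon> > 0\<close> unfolding cb_analysable_iff_fragmented by blast
      have "openin (subtopology ?S V) U"
        using U(1) \<open>V \<subseteq> Y\<close> by (simp add: subtopology_subtopology inf.absorb2)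
      then show ?thesis
        using U V(1) openin_open_subtopology by blast
    qed
    have "?S closure_of {x. d_isolated ?S d x} = topspace ?S"
      unfolding dense_intersects_open
      using fragmented_imp_d_isolated[OF _ H small] Y by blast
    then show "?S closure_of {x. d_isolated ?S d x} = Y"
      by (simp only: S)
  qed
  have ii_iii: ?iii if ?ii
  proof (intro allI impI)
    fix Y assume Y: "closedin T Y \<and> Y \<noteq> {}"
    have "subtopology T Y closure_of {x. d_isolated (subtopology T Y) d x} = Y"
      using \<open>?ii\<close> Y closedin_subset locally_compact_space_closed_subset[OF assms(2)] by blast
    then have "{x. d_isolated (subtopology T Y) d x} \<noteq> {}"
      using Y by (metis closure_of_empty)
    then show "\<exists>x. weakly_d_isolated (subtopology T Y) d x"
      using d_isolated_imp_weakly_d_isolated[of "subtopology T Y" d] by auto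
  qed
  have iii_i: ?i if ?iii
    unfolding cb_analysable_def
  proof (intro allI impI, rule ccontr)
    fix \<epsilon> :: real assume "\<epsilon> > 0" and ne: "cb_kernel T d \<epsilon> \<noteq> {}"
    define Y where "Y = T closure_of cb_kernel T d \<epsilon>"
    have YT: "Y \<subseteq> topspace T"
      by (simp add: Y_def closure_of_subset_topspace)
    have perfect: "cb_derivative (subtopology T Y) d \<epsilon> = Y"
      unfolding Y_def
      by (rule cb_derivative_closure_of_eq_self[OF cb_kernel_subset_topspace cb_kernel_fixpoint])
    have "Y \<noteq> {}"
      using ne closure_of_subset[OF cb_kernel_subset_topspace, of T d \<epsilon>] unfolding Y_def by blast
    moreover have "closedin T Y"
      by (simp add: Y_def)
    ultimately obtain x where x: "weakly_d_isolated (subtopology T Y) d x"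
      using \<open>?iii\<close> by blast
    interpret Y: topometric_space "subtopology T Y" d
      by (rule topometric_space_subtopology[OF assms(1)])
    let ?B = "d_ball (subtopology T Y) d x (\<epsilon> / 2)"
    let ?U = "subtopology T Y interior_of ?B"
    have "d_diam d ?U \<le> d_diam d ?B"
      by (rule d_diam_mono[OF interior_of_subset])
    also have "\<dots> \<le> ennreal \<epsilon>"
      using Y.d_diam_d_ball_le[of x "\<epsilon> / 2"] x \<open>\<epsilon> > 0\<close> by (simp add: weakly_d_isolated_def)
    finally have "?U = {}"
      using perfect cb_derivative_eq_self_iff[OF YT, of d \<epsilon>] openin_interior_of[of "subtopology T Y" ?B]
      by blast
    moreover have "?U \<noteq> {}"
      using x \<open>\<epsilon> > 0\<close> by (simp add: weakly_d_isolated_def)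
    ultimately show False
      by contradiction
  qed
  show ?thesis
    using i_ii ii_iii iii_i by blast
qed

end
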